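(* For $t>0$ and $g=e^pe^{i\phi}\in\mathbb C\setminus\{0\}$ ($p,\phi\in\mathbb R$) let $\psi^t_g(h)=\sum_{n\in\mathbb Z}e^{-\frac t2n^2}(gh^{-1})^n$, $h\in U(1)$, let $\tilde\psi^t_g(n)=e^{-tn^2/2}e^{in\phi}e^{np}$, $n\in\mathbb Z$, be its electric field representation (Fourier coefficients), and let $$p^t_g(n):=\frac{|\tilde\psi^t_g(n)|^2}{\|\psi^t_g\|^2}.$$ There exists a positive $K_t$, depending only on $t$ (not on $g$ or $n$) and vanishing exponentially fast as $t\to0$, such that for every $t>0$ with $K_t<1$, all $g\in\mathbb C\setminus\{0\}$ and all $n\in\mathbb Z$ $$p^t_g(n)\le\frac{\sqrt{\frac t\pi}\,e^{-\frac{(tn-p)^2}{t}}}{1-K_t} .$$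
   Context: $\|\cdot\|$ is the norm of $L_2(U(1),d\phi/2\pi)$. "Vanishing exponentially fast as $t\to0$" means: there are $C,c,t_0>0$ with $0<K_t\le Ce^{-c/t}$ for $0<t<t_0$. *)

theory Defs
  imports "HOL-Analysis.Analysis"
begin

text \<open>Elements of \<open>U(1)\<close> are the complex numbers of modulus one.\<close>

definition coherent_state :: "real \<Rightarrow> complex \<Rightarrow> complex \<Rightarrow> complex" where
  "coherent_state t g h =
     (\<Sum>\<^sub>\<infinity>n\<in>(UNIV::int set). complex_of_real (exp (- (t / 2) * (real_of_int n)\<^sup>2)) * (g * inverse h) powi n)"

definition norm_U1 :: "(complex \<Rightarrow> complex) \<Rightarrow> real" where
  "norm_U1 f = sqrt ((LINT \<theta>:{0..2*pi}|lborel. (cmod (f (cis \<theta>)))\<^sup>2) / (2 * pi))"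

text \<open>
  The \<open>n\<close>-th coefficient of \<open>coherent_state t g\<close>, namely that of \<open>h \<mapsto> inverse h powi n\<close>.
  For \<open>g = exp p * exp (\<i> * \<phi>)\<close> the number \<open>p\<close> is determined by \<open>g\<close>, whereas \<open>\<phi>\<close> is determined
  only modulo \<open>2 * pi\<close>; \<open>electric_rep_polar\<close> below shows that the choice does not matter.
\<close>

definition electric_rep :: "real \<Rightarrow> complex \<Rightarrow> int \<Rightarrow> complex" where
  "electric_rep t g n =
     (let p = ln (cmod g); \<phi> = Arg g in
        complex_of_real (exp (- t * (real_of_int n)\<^sup>2 / 2))
        * exp (\<i> * of_int n * complex_of_real \<phi>)
        * complex_of_real (exp (real_of_int n * p)))"

lemma electric_rep_polar:
  assumes "g = complex_of_real (exp p) * exp (\<i> * complex_of_real \<phi>)"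
  shows "electric_rep t g n =
     complex_of_real (exp (- t * (real_of_int n)\<^sup>2 / 2))
     * exp (\<i> * of_int n * complex_of_real \<phi>)
     * complex_of_real (exp (real_of_int n * p))"
proof -
  have norm_g: "cmod g = exp p"
    using assms by (simp add: norm_mult)
  then have "g \<noteq> 0"
    by auto
  then have "g = complex_of_real (cmod g) * exp (\<i> * complex_of_real (Arg g))"
    by (metis Arg_eq)
  then have eq: "exp (\<i> * complex_of_real (Arg g)) = exp (\<i> * complex_of_real \<phi>)"
    using assms norm_g by (metis exp_not_eq_zero mult_cancel_left of_real_eq_0_iff)
  have powi: "exp (\<i> * of_int n * complex_of_real x) = exp (\<i> * complex_of_real x) powi n" for x
    by (simp add: exp_power_int mult_ac)
  show ?thesis
    by (simp add: electric_rep_def Let_def norm_g powi eq)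
qed

definition occupation_prob :: "real \<Rightarrow> complex \<Rightarrow> int \<Rightarrow> real" where
  "occupation_prob t g n = (cmod (electric_rep t g n))\<^sup>2 / (norm_U1 (coherent_state t g))\<^sup>2"

definition vanishes_exponentially_at_0 :: "(real \<Rightarrow> real) \<Rightarrow> bool" where
  "vanishes_exponentially_at_0 K \<longleftrightarrow>
     (\<exists>C>0. \<exists>c>0. \<exists>t\<^sub>0>0. \<forall>t. 0 < t \<and> t < t\<^sub>0 \<longrightarrow> 0 < K t \<and> K t \<le> C * exp (- c / t))"

end

(*
By Parseval, the squared norm of the coherent state is the sum of exp (- t n^2 + 2 n p) over the
integers n, that is exp (p^2 / t) sqrt (pi / t) F (p / t), where F is the sum of the integer
translates of the centred normal density with variance 1 / (2 t).  So a lower bound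
F >= 1 - K t with exponentially small K t is all that is needed.  Instead of Poisson summation a
Doeblin argument is used: F is the heat kernel of the circle at time proportional to 1 / t, it has
mean 1, and increasing the variance by 1 convolves it with a probability density bounded below by
a constant d > 0 on a full period.  This multiplies the deficit 1 - min F by at most 1 - d.
*)
theory Submission
  imports Defs "HOL-Probability.Distributions"
begin

section \<open>Periodized normal densities\<close>

text \<open>The parameter \<open>v\<close> is the variance, hence the standard deviation
  \<open>sqrt v\<close>. Values in \<open>ennreal\<close> allow sums and integrals to be exchanged
  without summability checks.\<close>

definition lattice_normal :: "real \<Rightarrow> real \<Rightarrow> ennreal" where
  "lattice_normal v x = (\<integral>\<^sup>+n. ennreal (normal_density 0 (sqrt v) (x - of_int n)) \<partial>count_space (UNIV :: int set))"

lemma measurable_lattice_normal [measurable]: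
  "lattice_normal v \<in> borel_measurable borel"
  unfolding lattice_normal_def
  by (rule sigma_finite_measure.borel_measurable_nn_integral)
     (use sigma_finite_measure_count_space_countable[of "UNIV::int set"] in auto)

text \<open>Variances add when centred normal densities are convolved. Only one factor is
  periodized, so the integral runs over the whole line.\<close>

lemma lattice_normal_convolution:
  assumes "v > 0" "w > 0"
  shows "lattice_normal (v + w) x = (\<integral>\<^sup>+y. lattice_normal v (x - y) * ennreal (normal_density 0 (sqrt w) y) \<partial>lborel)"
proof -
  have "lattice_normal (v + w) x = (\<integral>\<^sup>+n. \<integral>\<^sup>+y. ennreal (normal_density 0 (sqrt v) (x - of_int n - y) * normal_density 0 (sqrt w) y) \<partial>lborel \<partial>count_space UNIV)"
    unfolding lattice_normal_def
    using fun_cong[OF conv_normal_density_zero_mean[of "sqrt v" "sqrt w"]] assms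
    by (intro nn_integral_cong) simp
  also have "\<dots> = (\<integral>\<^sup>+y. \<integral>\<^sup>+n. ennreal (normal_density 0 (sqrt v) (x - of_int n - y) * normal_density 0 (sqrt w) y) \<partial>count_space (UNIV::int set) \<partial>lborel)"
    by (rule nn_integral_count_space_nn_integral [symmetric]) auto
  also have "\<dots> = (\<integral>\<^sup>+y. lattice_normal v (x - y) * ennreal (normal_density 0 (sqrt w) y) \<partial>lborel)"
    unfolding lattice_normal_def
    by (intro nn_integral_cong) (simp add: ennreal_mult algebra_simps flip: nn_integral_cmult)
  finally show ?thesis .
qed

lemma nn_integral_eq_sum_unit_intervals:
  fixes f :: "real \<Rightarrow> ennreal"
  assumes [measurable]: "f \<in> borel_measurable borel"
  shows "(\<integral>\<^sup>+x. f x \<partial>lborel) = (\<integral>\<^sup>+n. \<integral>\<^sup>+y. f (of_int n + y) * indicator {0..<1} y \<partial>lborel \<partial>count_space (UNIV :: int set))"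
proof -
  \<comment> \<open>For each \<open>x\<close> exactly one \<open>n\<close>, its floor, survives in
    the sum over \<open>n\<close>; this reassembles the line from the unit intervals.\<close>
  have ind: "indicator {0..<1} (x - of_int n) = (indicator {\<lfloor>x\<rfloor>} n :: ennreal)" for x :: real and n :: int
    by (auto simp: indicator_def) linarith+
  have "(\<integral>\<^sup>+n. \<integral>\<^sup>+y. f (of_int n + y) * indicator {0..<1} y \<partial>lborel \<partial>count_space (UNIV :: int set))
     = (\<integral>\<^sup>+n. \<integral>\<^sup>+x. f x * indicator {0..<1} (x - of_int n) \<partial>lborel \<partial>count_space (UNIV :: int set))"
  proof (rule nn_integral_cong)
    fix n :: int
    show "(\<integral>\<^sup>+y. f (of_int n + y) * indicator {0..<1} y \<partial>lborel) = (\<integral>\<^sup>+x. f x * indicator {0..<1} (x - of_int n) \<partial>lborel)"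
      by (subst (2) nn_integral_real_affine[of _ 1 "of_int n"]) auto
  qed
  also have "\<dots> = (\<integral>\<^sup>+x. \<integral>\<^sup>+n. f x * indicator {0..<1} (x - of_int n) \<partial>count_space (UNIV :: int set) \<partial>lborel)"
    by (rule nn_integral_count_space_nn_integral [symmetric]) auto
  also have "\<dots> = (\<integral>\<^sup>+x. f x \<partial>lborel)"
    by (simp add: ind nn_integral_cmult)
  finally show ?thesis by simp
qed

text \<open>Integrating all translates over one period unfolds to the integral of a single normal
  density over the line.\<close>

lemma integral_lattice_normal_unit_interval:
  assumes "v > 0"
  shows "(\<integral>\<^sup>+y. lattice_normal v (x - y) * indicator {0..<1} y \<partial>lborel) = 1"
proof -
  have "(\<integral>\<^sup>+y. lattice_normal v (x - y) * indicator {0..<1} y \<partial>lborel)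
    = (\<integral>\<^sup>+y. \<integral>\<^sup>+n. ennreal (normal_density 0 (sqrt v) (x - (of_int n + y))) * indicator {0..<1} y \<partial>count_space (UNIV::int set) \<partial>lborel)"
    unfolding lattice_normal_def
    by (intro nn_integral_cong) (simp add: algebra_simps flip: nn_integral_cmult)
  also have "\<dots> = (\<integral>\<^sup>+n. \<integral>\<^sup>+y. ennreal (normal_density 0 (sqrt v) (x - (of_int n + y))) * indicator {0..<1} y \<partial>lborel \<partial>count_space (UNIV::int set))"
    by (rule nn_integral_count_space_nn_integral) auto
  also have "\<dots> = (\<integral>\<^sup>+y. ennreal (normal_density 0 (sqrt v) (x - y)) \<partial>lborel)"
    by (rule nn_integral_eq_sum_unit_intervals [symmetric]) auto
  also have "\<dots> = (\<integral>\<^sup>+y. ennreal (normal_density 0 (sqrt v) y) \<partial>lborel)"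
    by (subst (2) nn_integral_real_affine[of _ "-1" x]) auto
  also have "\<dots> = 1"
    using assms by (simp add: nn_integral_eq_integral)
  finally show ?thesis .
qed

section \<open>Doeblin contraction of the deficit\<close>

text \<open>The minimum of the standard normal density on \<open>{0..1}\<close>, attained at the
  right end; it bounds the density from below on the full period \<open>{0..<1}\<close>.\<close>

definition minorization_const :: real where
  "minorization_const = normal_density 0 1 1"

lemma minorization_const_bounds:
  shows "0 < minorization_const" and "minorization_const < 1"
proof -
  show "0 < minorization_const" by (simp add: minorization_const_def normal_density_pos)
  have "1 < sqrt (2 * pi)" using pi_gt3 by simp
  moreover have "exp (-1/2 :: real) < 1" by simp
  ultimately show "minorization_const < 1"
    unfolding minorization_const_def normal_density_def
    using mult_strict_mono[of "exp (- 1 / 2)" 1 1 "sqrt (2 * pi)"] by (simp add: field_simps)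
qed

text \<open>
  Split the standard normal density as \<open>minorization_const * indicator {0..<1} + r\<close> with \<open>r \<ge> 0\<close>:
  the first part contributes exactly \<open>minorization_const\<close> because \<open>lattice_normal v\<close> has mean 1 over a period.
\<close>

lemma lattice_normal_step:
  assumes "v > 0" "0 \<le> e" "e \<le> 1" and lb: "\<And>x. ennreal (1 - e) \<le> lattice_normal v x"
  shows "ennreal (1 - (1 - minorization_const) * e) \<le> lattice_normal (v + 1) x"
proof -
  define r where "r y = normal_density 0 1 y - minorization_const * indicator {0..<1} y" for y :: real
  have [measurable]: "r \<in> borel_measurable borel" unfolding r_def by measurable
  have r: "0 \<le> r y" for y
  proof (cases "y \<in> {0..<1}")
    case True
    then have "y\<^sup>2 \<le> 1" by (simp add: abs_square_le_1)
    then show ?thesis by (auto simp: r_def minorization_const_def normal_density_def indicator_def intro!: divide_right_mono)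
  next
    case False
    then show ?thesis by (simp add: r_def)
  qed
  have int_r: "(\<integral>\<^sup>+y. ennreal (r y) \<partial>lborel) = ennreal (1 - minorization_const)"
  proof -
    have "has_bochner_integral lborel r (1 - minorization_const * 1)"
      unfolding r_def
      by (intro has_bochner_integral_diff has_bochner_integral_mult_right)
         (auto simp: has_bochner_integral_iff)
    then show ?thesis
      using r by (simp add: has_bochner_integral_iff nn_integral_eq_integral)
  qed
  \<comment> \<open>The new bound averages the old bound \<open>1 - e\<close>, weighted by the mass
    of \<open>r\<close>, and the exact mean 1, weighted by
    \<open>minorization_const\<close>.\<close>
  have "ennreal (1 - (1 - minorization_const) * e) = ennreal (1 - e) * ennreal (1 - minorization_const) + ennreal minorization_const"
  proof -
    have "1 - (1 - minorization_const) * e = (1 - e) * (1 - minorization_const) + minorization_const"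
      by (simp add: algebra_simps)
    then show ?thesis
      using assms minorization_const_bounds by (simp add: ennreal_mult)
  qed
  also have "\<dots> = (\<integral>\<^sup>+y. ennreal (1 - e) * ennreal (r y) \<partial>lborel)
      + (\<integral>\<^sup>+y. ennreal minorization_const * (lattice_normal v (x - y) * indicator {0..<1} y) \<partial>lborel)"
    using assms by (simp add: nn_integral_cmult int_r integral_lattice_normal_unit_interval)
  also have "\<dots> \<le> (\<integral>\<^sup>+y. lattice_normal v (x - y) * ennreal (r y) \<partial>lborel)
      + (\<integral>\<^sup>+y. ennreal minorization_const * (lattice_normal v (x - y) * indicator {0..<1} y) \<partial>lborel)"
    by (intro add_mono nn_integral_mono mult_right_mono lb) auto
  also have "\<dots> = (\<integral>\<^sup>+y. lattice_normal v (x - y) * ennreal (r y) +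
       ennreal minorization_const * (lattice_normal v (x - y) * indicator {0..<1} y) \<partial>lborel)"
    by (rule nn_integral_add [symmetric]) auto
  also have "\<dots> = (\<integral>\<^sup>+y. lattice_normal v (x - y) * ennreal (normal_density 0 1 y) \<partial>lborel)"
  proof (rule nn_integral_cong)
    fix y
    have "ennreal (normal_density 0 1 y) = ennreal (r y) + ennreal minorization_const * indicator {0..<1} y"
      using r[of y] minorization_const_bounds by (auto simp: r_def indicator_def simp flip: ennreal_plus)
    then show "lattice_normal v (x - y) * ennreal (r y) + ennreal minorization_const * (lattice_normal v (x - y) * indicator {0..<1} y)
      = lattice_normal v (x - y) * ennreal (normal_density 0 1 y)"
      by (simp add: distrib_left mult_ac)
  qed
  also have "\<dots> = lattice_normal (v + 1) x"
    using lattice_normal_convolution[of v 1 x] assms by simp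
  finally show ?thesis .
qed

text \<open>The induction starts from the trivial bound 0, a deficit of 1; every added unit of
  variance multiplies the deficit by \<open>1 - minorization_const\<close>.\<close>

lemma lattice_normal_lower_bound_nat:
  assumes "v > 0"
  shows "ennreal (1 - (1 - minorization_const) ^ k) \<le> lattice_normal (v + real k) x"
proof (induction k arbitrary: x)
  case (Suc k)
  then have "ennreal (1 - (1 - minorization_const) * (1 - minorization_const) ^ k) \<le> lattice_normal (v + real k + 1) x"
    using assms minorization_const_bounds by (intro lattice_normal_step) (auto intro!: power_le_one)
  then show ?case by (simp add: algebra_simps)
qed simp

text \<open>A variance splits into a positive remainder and \<open>k\<close> unit steps. For
  \<open>v < 1\<close> the real bound is negative and \<open>ennreal\<close> sends it to 0.\<close>

lemma lattice_normal_lower_bound: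
  assumes "v > 0"
  shows "ennreal (1 - (1 - minorization_const) powr (v - 1)) \<le> lattice_normal v x"
proof -
  \<comment> \<open>The largest integer strictly below \<open>v\<close>; the floor would leave the
    remainder 0 when \<open>v\<close> is an integer.\<close>
  define k where "k = nat (\<lceil>v\<rceil> - 1)"
  have k: "real k < v" "v \<le> real k + 1"
    using assms unfolding k_def by linarith+
  have "(1 - minorization_const) ^ k \<le> (1 - minorization_const) powr (v - 1)"
    using minorization_const_bounds k by (subst powr_realpow [symmetric]) (auto intro!: powr_mono')
  then have "ennreal (1 - (1 - minorization_const) powr (v - 1)) \<le> ennreal (1 - (1 - minorization_const) ^ k)"
    by (intro ennreal_leI) simp
  also have "\<dots> \<le> lattice_normal v x"
    using lattice_normal_lower_bound_nat[of "v - real k" k x] k by simp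
  finally show ?thesis .
qed

section \<open>Parseval's identity on the circle\<close>

lemma integral_cis:
  fixes k :: int
  shows "(LINT \<theta>:{0..2*pi}|lborel. cis (of_int k * \<theta>)) = (if k = 0 then 2 * pi else 0)"
proof (cases "k = 0")
  case True
  then show ?thesis by (simp add: set_lebesgue_integral_def scaleR_conv_of_real)
next
  case False
  \<comment> \<open>An antiderivative; it is \<open>2 * pi\<close>-periodic, so its boundary values
    cancel.\<close>
  define F where "F \<theta> = cis (of_int k * \<theta>) / (\<i> * of_int k)" for \<theta> :: real
  have "((\<lambda>\<theta>. cis (of_int k * \<theta>) / (\<i> * of_int k)) has_vector_derivative cis (of_int k * \<theta>)) (at \<theta> within S)" for \<theta> S
    unfolding cis_conv_exp using False
    by (auto intro!: derivative_eq_intros has_vector_derivative_real_field simp: mult_ac)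
  then have "(\<integral>\<theta>. indicator {0..2*pi} \<theta> *\<^sub>R cis (of_int k * \<theta>) \<partial>lborel) = F (2 * pi) - F 0"
    unfolding F_def by (intro integral_FTC_Icc) (auto intro!: continuous_intros)
  moreover have "cis (of_int k * (2 * pi)) = 1"
    by (metis cis_multiple_2pi mult.commute Ints_of_int)
  ultimately show ?thesis
    using False by (simp add: set_lebesgue_integral_def F_def)
qed

text \<open>The square expands into a double sum of which orthogonality leaves the diagonal. The
  sign in \<open>cis\<close> reflects that coherent states are series in
  \<open>inverse h\<close>.\<close>

lemma parseval_finite:
  fixes a :: "int \<Rightarrow> complex"
  assumes "finite A"
  shows "(LINT \<theta>:{0..2*pi}|lborel. (cmod (\<Sum>n\<in>A. a n * cis (- (of_int n * \<theta>))))\<^sup>2) = 2 * pi * (\<Sum>n\<in>A. (cmod (a n))\<^sup>2)"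
proof -
  have int: "set_integrable lborel {0..2*pi} (\<lambda>\<theta>. a n * cnj (a m) * cis (of_int (m - n) * \<theta>))" for n m
    by (intro borel_integrable_atLeastAtMost' continuous_intros)
  have "complex_of_real (LINT \<theta>:{0..2*pi}|lborel. (cmod (\<Sum>n\<in>A. a n * cis (- (of_int n * \<theta>))))\<^sup>2)
      = (LINT \<theta>:{0..2*pi}|lborel. (\<Sum>n\<in>A. \<Sum>m\<in>A. a n * cnj (a m) * cis (of_int (m - n) * \<theta>)))"
    unfolding set_integral_complex_of_real [symmetric] complex_norm_square
    by (intro set_lebesgue_integral_cong)
       (auto simp: sum_product cis_cnj cis_mult algebra_simps intro!: sum.cong)
  also have "\<dots> = (\<Sum>n\<in>A. \<Sum>m\<in>A. a n * cnj (a m) * (LINT \<theta>:{0..2*pi}|lborel. cis (of_int (m - n) * \<theta>)))"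
    using int unfolding set_lebesgue_integral_def set_integrable_def scaleR_sum_right
    by (simp add: Bochner_Integration.integral_sum flip: mult_scaleR_right)
  also have "\<dots> = (\<Sum>n\<in>A. \<Sum>m\<in>A. if n = m then 2 * pi * a n * cnj (a n) else 0)"
    by (intro sum.cong) (auto simp: integral_cis simp del: of_int_diff)
  also have "\<dots> = complex_of_real (2 * pi * (\<Sum>n\<in>A. (cmod (a n))\<^sup>2))"
    using assms by (simp add: complex_norm_square sum_distrib_left mult_ac del: of_real_power)
  finally show ?thesis
    unfolding of_real_eq_iff .
qed

text \<open>Turns the unordered limit defining \<open>infsum\<close> into a limit of a sequence, as
  dominated convergence requires.\<close>

lemma filterlim_symmetric_intervals:
  "filterlim (\<lambda>N. {- int N..int N}) (finite_subsets_at_top UNIV) sequentially"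
  unfolding filterlim_finite_subsets_at_top
proof (intro allI impI)
  fix X :: "int set" assume "finite X \<and> X \<subseteq> UNIV"
  then obtain B where B: "\<And>x. x \<in> X \<Longrightarrow> \<bar>x\<bar> \<le> B"
    by (metis finite_imageI bdd_above_finite bdd_above.E imageI)
  show "\<forall>\<^sub>F N in sequentially. finite {- int N..int N} \<and> X \<subseteq> {- int N..int N} \<and> {- int N..int N} \<subseteq> UNIV"
    using eventually_ge_at_top[of "nat B"]
    by eventually_elim (use B in \<open>force simp: abs_le_iff\<close>)
qed

text \<open>The symmetric partial sums are bounded uniformly by \<open>M\<close>, so dominated
  convergence with the constant \<open>M\<^sup>2\<close> on the bounded interval passes to the limit
  in the finite identity.\<close>

lemma parseval_abs_summable:
  fixes a :: "int \<Rightarrow> complex"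
  assumes "(\<lambda>n. cmod (a n)) summable_on UNIV"
  shows "(LINT \<theta>:{0..2*pi}|lborel. (cmod (\<Sum>\<^sub>\<infinity>n. a n * cis (- (of_int n * \<theta>))))\<^sup>2) = 2 * pi * (\<Sum>\<^sub>\<infinity>n. (cmod (a n))\<^sup>2)"
proof -
  define S where "S N \<theta> = (\<Sum>n\<in>{- int N..int N}. a n * cis (- (of_int n * \<theta>)))" for N \<theta>
  define M where "M = (\<Sum>\<^sub>\<infinity>n. cmod (a n))"
  have bound: "cmod (S N \<theta>) \<le> M" for N \<theta>
  proof -
    have "cmod (S N \<theta>) \<le> (\<Sum>n\<in>{- int N..int N}. cmod (a n))"
      unfolding S_def by (rule sum_norm_le) (simp add: norm_mult)
    also have "\<dots> \<le> M"
      unfolding M_def using assms by (intro finite_sum_le_infsum) auto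
    finally show ?thesis .
  qed
  have lim: "(\<lambda>N. S N \<theta>) \<longlonglongrightarrow> (\<Sum>\<^sub>\<infinity>n. a n * cis (- (of_int n * \<theta>)))" for \<theta>
  proof -
    have "(\<lambda>n. a n * cis (- (of_int n * \<theta>))) summable_on UNIV"
      by (rule abs_summable_summable) (use assms in \<open>simp add: norm_mult\<close>)
    then show ?thesis
      unfolding S_def by (intro filterlim_compose[OF _ filterlim_symmetric_intervals] infsum_tendsto)
  qed
  have [measurable]: "(\<lambda>\<theta>. S N \<theta>) \<in> borel_measurable borel" for N
    unfolding S_def by (intro borel_measurable_continuous_onI continuous_intros)
  have [measurable]: "(\<lambda>\<theta>. \<Sum>\<^sub>\<infinity>n. a n * cis (- (of_int n * \<theta>))) \<in> borel_measurable borel"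
    by (rule borel_measurable_LIMSEQ_metric[OF _ lim]) measurable
  have "(\<lambda>N. LINT \<theta>:{0..2*pi}|lborel. (cmod (S N \<theta>))\<^sup>2)
      \<longlonglongrightarrow> (LINT \<theta>:{0..2*pi}|lborel. (cmod (\<Sum>\<^sub>\<infinity>n. a n * cis (- (of_int n * \<theta>))))\<^sup>2)"
    unfolding set_lebesgue_integral_def
  proof (rule integral_dominated_convergence)
    show "integrable lborel (\<lambda>\<theta>. indicator {0..2*pi} \<theta> *\<^sub>R M\<^sup>2)"
      by (simp add: integrable_real_mult_indicator)
    show "AE \<theta> in lborel. norm (indicator {0..2*pi} \<theta> *\<^sub>R (cmod (S N \<theta>))\<^sup>2) \<le> indicator {0..2*pi} \<theta> *\<^sub>R M\<^sup>2" for N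
      using bound by (auto simp: indicator_def intro!: AE_I2 power_mono)
    show "AE \<theta> in lborel. (\<lambda>N. indicator {0..2*pi} \<theta> *\<^sub>R (cmod (S N \<theta>))\<^sup>2)
        \<longlonglongrightarrow> indicator {0..2*pi} \<theta> *\<^sub>R (cmod (\<Sum>\<^sub>\<infinity>n. a n * cis (- (of_int n * \<theta>))))\<^sup>2"
      by (intro AE_I2 tendsto_intros lim)
  qed auto
  then have "(\<lambda>N. 2 * pi * (\<Sum>n\<in>{- int N..int N}. (cmod (a n))\<^sup>2))
      \<longlonglongrightarrow> (LINT \<theta>:{0..2*pi}|lborel. (cmod (\<Sum>\<^sub>\<infinity>n. a n * cis (- (of_int n * \<theta>))))\<^sup>2)"
    unfolding S_def by (subst (asm) parseval_finite) auto
  moreover have "(\<lambda>N. 2 * pi * (\<Sum>n\<in>{- int N..int N}. (cmod (a n))\<^sup>2)) \<longlonglongrightarrow> 2 * pi * (\<Sum>\<^sub>\<infinity>n. (cmod (a n))\<^sup>2)"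
  proof -
    \<comment> \<open>Gives square summability, since the square of \<open>cmod (a n)\<close> is at
      most \<open>M * cmod (a n)\<close>.\<close>
    have M: "cmod (a n) \<le> M" for n
      using finite_sum_le_infsum[OF assms, of "{n}"] by (simp add: M_def)
    have "(\<lambda>n. (cmod (a n))\<^sup>2) summable_on UNIV"
      by (rule summable_on_comparison_test[OF summable_on_cmult_right[OF assms, of M]])
         (auto simp: power2_eq_square intro!: mult_right_mono M)
    then show ?thesis
      by (intro tendsto_intros filterlim_compose[OF _ filterlim_symmetric_intervals] infsum_tendsto)
  qed
  ultimately show ?thesis
    by (rule LIMSEQ_unique)
qed

section \<open>Gaussian sums and the norm of the coherent state\<close>

lemma summable_on_exp_abs: "(\<lambda>n::int. exp (- \<bar>real_of_int n\<bar>)) summable_on UNIV"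
proof -
  have nat: "(\<lambda>n::nat. exp (- real n)) summable_on UNIV"
    using summable_geometric[of "exp (-1::real)"]
    by (subst summable_on_UNIV_nonneg_real_iff) (simp_all flip: exp_of_nat_mult)
  have "(\<lambda>n. exp (- \<bar>real_of_int n\<bar>)) summable_on range int"
    using nat by (subst summable_on_reindex) (auto simp: o_def)
  moreover have "(\<lambda>n. exp (- \<bar>real_of_int n\<bar>)) summable_on range (\<lambda>n. - int n)"
    using nat by (subst summable_on_reindex) (auto simp: o_def inj_on_def)
  moreover have "range int \<union> range (\<lambda>n. - int n) = UNIV"
    by (auto intro: int_cases2)
  ultimately show ?thesis
    using summable_on_union by fastforce
qed

lemma summable_on_exp_quadratic:
  fixes s b :: real
  assumes "s > 0"
  shows "(\<lambda>n::int. exp (- s * (of_int n)\<^sup>2 + of_int n * b)) summable_on UNIV"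
proof (rule summable_on_comparison_test)
  \<comment> \<open>The maximum of
    \<open>- s * x\<^sup>2 + \<bar>x\<bar> * (\<bar>b\<bar> + 1)\<close> over real \<open>x\<close>;
    the extra 1 pays for the decay of \<open>exp (- \<bar>x\<bar>)\<close>.\<close>
  define C where "C = (\<bar>b\<bar> + 1)\<^sup>2 / (4 * s)"
  show "(\<lambda>n::int. exp C * exp (- \<bar>real_of_int n\<bar>)) summable_on UNIV"
    by (intro summable_on_cmult_right summable_on_exp_abs)
  show "exp (- s * (of_int n)\<^sup>2 + of_int n * b) \<le> exp C * exp (- \<bar>real_of_int n\<bar>)" for n
  proof -
    define x where "x = real_of_int n"
    have "0 \<le> (2 * s * \<bar>x\<bar> - (\<bar>b\<bar> + 1))\<^sup>2 / (4 * s)"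
      using assms by simp
    also have "\<dots> = s * x\<^sup>2 - \<bar>x\<bar> * (\<bar>b\<bar> + 1) + C"
      using assms unfolding C_def by (simp add: power2_diff power_mult_distrib diff_divide_distrib add_divide_distrib) (simp add: field_simps power2_eq_square)
    finally have "- s * x\<^sup>2 + \<bar>x\<bar> * \<bar>b\<bar> \<le> C - \<bar>x\<bar>"
      by (simp add: algebra_simps)
    moreover have "x * b \<le> \<bar>x\<bar> * \<bar>b\<bar>"
      by (metis abs_ge_self abs_mult)
    ultimately show ?thesis
      unfolding x_def by (simp flip: exp_add)
  qed
qed auto

text \<open>Parseval applied to the coefficients \<open>a n\<close>; the phase of \<open>g\<close>
  drops out of their moduli.\<close>

lemma norm_coherent_state:
  assumes "t > 0" and g: "g = complex_of_real (exp p) * exp (\<i> * complex_of_real \<phi>)"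
  shows "(norm_U1 (coherent_state t g))\<^sup>2 = (\<Sum>\<^sub>\<infinity>n::int. exp (- t * (of_int n)\<^sup>2 + of_int n * (2 * p)))"
proof -
  define a where "a n = complex_of_real (exp (- (t / 2) * (real_of_int n)\<^sup>2)) * g powi n" for n
  have cmod_a: "cmod (a n) = exp (- (t / 2) * (of_int n)\<^sup>2 + of_int n * p)" for n
    using exp_power_int[of p n]
    by (simp add: a_def g norm_mult norm_power_int mult.commute flip: exp_add)
  have "coherent_state t g (cis \<theta>) = (\<Sum>\<^sub>\<infinity>n. a n * cis (- (of_int n * \<theta>)))" for \<theta>
    unfolding coherent_state_def a_def
    by (intro infsum_cong) (simp add: power_int_mult_distrib cis_power_int)
  moreover have "(\<lambda>n. cmod (a n)) summable_on UNIV"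
    unfolding cmod_a using assms by (intro summable_on_exp_quadratic) auto
  ultimately have "(norm_U1 (coherent_state t g))\<^sup>2 = (\<Sum>\<^sub>\<infinity>n. (cmod (a n))\<^sup>2)"
    unfolding norm_U1_def by (simp add: parseval_abs_summable infsum_nonneg)
  also have "\<dots> = (\<Sum>\<^sub>\<infinity>n. exp (- t * (of_int n)\<^sup>2 + of_int n * (2 * p)))"
    unfolding cmod_a by (intro infsum_cong) (simp add: power2_eq_square flip: exp_add)
  finally show ?thesis .
qed

text \<open>Completing the square in \<open>n\<close> turns the summand, up to the factor
  \<open>c\<close>, into the normal density of variance \<open>1 / (2 * t)\<close> at
  \<open>p / t - n\<close>. The sum is thus a rescaled \<open>lattice_normal\<close>.\<close>

lemma gaussian_sum_lower_bound:
  fixes t p :: real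
  assumes "t > 0"
  shows "(1 - (1 - minorization_const) powr (1 / (2 * t) - 1)) * exp (p\<^sup>2 / t) / sqrt (t / pi)
    \<le> (\<Sum>\<^sub>\<infinity>n::int. exp (- t * (of_int n)\<^sup>2 + of_int n * (2 * p)))"
proof -
  define f where "f n = exp (- t * (of_int n)\<^sup>2 + of_int n * (2 * p))" for n :: int
  define c where "c = sqrt (t / pi) * exp (- (p\<^sup>2 / t))"
  have c: "c > 0" using assms by (simp add: c_def)
  have "normal_density 0 (sqrt (1 / (2 * t))) (p / t - of_int n) = c * f n" for n
  proof -
    have "- ((p / t - of_int n)\<^sup>2) * t = - (p\<^sup>2 / t) + (- t * (of_int n)\<^sup>2 + of_int n * (2 * p))"
      using assms by (simp add: power2_eq_square field_simps)
    moreover have "normal_density 0 (sqrt (1 / (2 * t))) y = sqrt (t / pi) * exp (- y\<^sup>2 * t)" for y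
    proof -
      have "(sqrt (1 / (2 * t)))\<^sup>2 = 1 / (2 * t)"
        using assms by (intro real_sqrt_pow2) simp
      then show ?thesis
        unfolding normal_density_def by (simp add: real_sqrt_divide mult.commute)
    qed
    ultimately show ?thesis
      by (simp only: c_def f_def mult.assoc exp_add [symmetric])
  qed
  then have eq: "lattice_normal (1 / (2 * t)) (p / t) = (\<integral>\<^sup>+n. ennreal (c * f n) \<partial>count_space UNIV)"
    by (simp add: lattice_normal_def)
  have summable: "(\<lambda>n. c * f n) summable_on UNIV"
    unfolding f_def by (intro summable_on_cmult_right summable_on_exp_quadratic assms)
  have nonneg: "0 \<le> c * f n" for n
    using c by (simp add: f_def)
  \<comment> \<open>\<open>infsetsum\<close> is the link between the integral over counting measure
    and \<open>infsum\<close>.\<close>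
  have "Infinite_Set_Sum.abs_summable_on (\<lambda>n. c * f n) UNIV"
    using summable nonneg by (simp flip: abs_summable_equivalent)
  then have "lattice_normal (1 / (2 * t)) (p / t) = ennreal (\<Sum>\<^sub>\<infinity>n. c * f n)"
    unfolding eq using nonneg by (simp add: nn_integral_conv_infsetsum infsetsum_infsum)
  then have "ennreal (1 - (1 - minorization_const) powr (1 / (2 * t) - 1)) \<le> ennreal (\<Sum>\<^sub>\<infinity>n. c * f n)"
    using lattice_normal_lower_bound[of "1 / (2 * t)" "p / t"] assms by simp
  \<comment> \<open>Leaving \<open>ennreal\<close> only requires the right-hand side to be
    nonnegative; the left one may be negative.\<close>
  then have "1 - (1 - minorization_const) powr (1 / (2 * t) - 1) \<le> (\<Sum>\<^sub>\<infinity>n. c * f n)"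
    using nonneg by (subst (asm) ennreal_le_iff) (auto intro: infsum_nonneg)
  also have "\<dots> = c * (\<Sum>\<^sub>\<infinity>n. f n)"
    by (rule infsum_cmult_right')
  finally show ?thesis
    using c assms unfolding c_def f_def by (simp add: field_simps exp_minus)
qed

section \<open>The bound on the occupation probabilities\<close>

theorem mainTheorem19:
  shows "\<exists>K :: real \<Rightarrow> real.
    (\<forall>t>0. 0 < K t) \<and> vanishes_exponentially_at_0 K \<and>
    (\<forall>t>0. K t < 1 \<longrightarrow>
      (\<forall>(g::complex) (p::real) (\<phi>::real) (n::int).
         g \<noteq> 0 \<and> g = complex_of_real (exp p) * exp (\<i> * complex_of_real \<phi>) \<longrightarrow>
         occupation_prob t g n
           \<le> sqrt (t / pi) * exp (- ((t * real_of_int n - p)\<^sup>2 / t)) / (1 - K t)))"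
proof -
  \<comment> \<open>The deficit bound at variance \<open>1 / (2 * t)\<close>, which is free of
    \<open>p\<close> and \<open>n\<close>.\<close>
  define K where "K t = (1 - minorization_const) powr (1 / (2 * t) - 1)" for t
  have pos: "0 < K t" for t
    using minorization_const_bounds by (simp add: K_def)
  have "vanishes_exponentially_at_0 K"
    unfolding vanishes_exponentially_at_0_def
  proof (intro exI conjI allI impI pos)
    fix t :: real
    assume "0 < t \<and> t < 1"
    \<comment> \<open>In fact an equality: \<open>1 / (2 * t)\<close> in the exponent gives the
      exponential, the \<open>- 1\<close> gives the prefactor. The rate is positive because
      \<open>1 - minorization_const\<close> lies strictly between 0 and 1.\<close>
    then show "K t \<le> 1 / (1 - minorization_const) * exp (- (- ln (1 - minorization_const) / 2) / t)"
      using minorization_const_bounds by (simp add: K_def powr_diff) (simp add: powr_def)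
  qed (use minorization_const_bounds in auto)
  moreover have "occupation_prob t g n
      \<le> sqrt (t / pi) * exp (- ((t * real_of_int n - p)\<^sup>2 / t)) / (1 - K t)"
    if "t > 0" "K t < 1" and g: "g = complex_of_real (exp p) * exp (\<i> * complex_of_real \<phi>)"
    for t g p \<phi> n
  proof -
    \<comment> \<open>The lower bound for the squared norm. It is positive because
      \<open>K t < 1\<close>, so it may replace the norm in the denominator.\<close>
    define L where "L = (1 - K t) * exp (p\<^sup>2 / t) / sqrt (t / pi)"
    have "L > 0"
      using that by (simp add: L_def)
    have "L \<le> (norm_U1 (coherent_state t g))\<^sup>2"
      using gaussian_sum_lower_bound[of t p] norm_coherent_state[OF _ g, of t] that
      by (simp add: L_def K_def)
    moreover have "(cmod (electric_rep t g n))\<^sup>2 = exp (- t * (of_int n)\<^sup>2 + of_int n * (2 * p))"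
      by (simp add: electric_rep_polar[OF g] norm_mult power2_eq_square flip: exp_add)
    ultimately have "occupation_prob t g n \<le> exp (- t * (of_int n)\<^sup>2 + of_int n * (2 * p)) / L"
      using \<open>L > 0\<close> unfolding occupation_prob_def by (intro frac_le) auto
    also have "\<dots> = sqrt (t / pi) * exp (- t * (of_int n)\<^sup>2 + of_int n * (2 * p) - p\<^sup>2 / t) / (1 - K t)"
      using that by (simp add: L_def exp_diff mult_ac)
    \<comment> \<open>The factor \<open>exp (p\<^sup>2 / t)\<close> of \<open>L\<close> supplies
      exactly the term that completes the square.\<close>
    also have "- t * (of_int n)\<^sup>2 + of_int n * (2 * p) - p\<^sup>2 / t = - ((t * of_int n - p)\<^sup>2 / t)"
      using \<open>t > 0\<close> by (simp add: power2_eq_square field_simps)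
    finally show ?thesis .
  qed
  ultimately show ?thesis
    using pos by blast
qed

end
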